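(* Let $\nu\in\mathcal{V}$ be a valuation on $\mathbb{K}[x]$ extending $\nu_0$, let $n\in\mathbb{N}$, and let $\Psi_n$ be the set of all key polynomials for $\nu$ of degree $n$. Assume that $\Psi_n\neq\emptyset$ and that $\{\nu(Q)\mid Q\in\Psi_n\}$ does not have a maximum, and let $Q_n$ be a limit key polynomial for $\Psi_n$. Then the family $\mathfrak{v}=\{\nu_Q\}_{Q\in\Psi_n}$ is a totally ordered subset of $\mathcal{V}$ with no maximum. Also, $Q_n$ is a polynomial of least degree that is not $\mathfrak{v}$-stable. If we take $\gamma=\nu(Q_n)$, then for every $f\in\mathbb{K}[x]$ $$\nu_{Q_n}(f)=\min_{0\le j\le r}\{\mathfrak{v}(f_j)+j\gamma\},$$ where $f_0,\ldots,f_r$ are the coefficients of the $Q_n$-expansion $f=f_0+f_1Q_n+\cdots+f_rQ_n^r$.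
   Context: A valuation on a commutative ring $A$ with unity is a map $\nu:A\to\Gamma_\infty=\Gamma\cup\{\infty\}$, with $\Gamma$ a totally ordered abelian group, such that $\nu(ab)=\nu(a)+\nu(b)$, $\nu(a+b)\ge\min\{\nu(a),\nu(b)\}$, $\nu(1)=0$, $\nu(0)=\infty$ (non-zero elements may have value $\infty$). Let $\mathbb{K}$ be a field, $\nu_0$ a valuation on $\mathbb{K}$ with value group $\Gamma_0$ (taking the value $\infty$ only at $0$), and fix a totally ordered divisible abelian group $\Gamma\supseteq\Gamma_0$. Put $\mathcal{V}=\{\nu_0\}\cup\{\nu:\mathbb{K}[x]\to\Gamma_\infty\mid \nu\text{ is a valuation extending }\nu_0\}$, partially ordered by $\nu_0\le\nu$ for all $\nu\in\mathcal{V}$, and, for $\nu,\mu\in\mathcal{V}\setminus\{\nu_0\}$, $\nu\le\mu$ iff $\nu(f)\le\mu(f)$ for all $f\in\mathbb{K}[x]$. Key polynomials: let $\overline{\mathbb{K}}$ be an algebraic closure of $\mathbb{K}$ and $\overline{\nu}$ a valuation on $\overline{\mathbb{K}}[x]$ extending $\nu$. For non-zero $f$ put $\delta(f)=\max\{\overline{\nu}(x-a)\mid a\in\overline{\mathbb{K}},\ f(a)=0\}$ if $\deg(f)>0$ and $\delta(f)=-\infty$ if $\deg(f)=0$; this is independent of the choices. A monic $Q\in\mathbb{K}[x]$ is a key polynomial for $\nu$ if for every non-zero $f\in\mathbb{K}[x]$, $\delta(f)\ge\delta(Q)$ implies $\deg(f)\ge\deg(Q)$. For a non-constant $q\in\mathbb{K}[x]$,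 the $q$-expansion of $f$ is the unique expression $f=f_0+f_1q+\cdots+f_sq^s$ with $\deg(f_i)<\deg(q)$ for all $i$. The truncation of $\nu$ at $q$ is $\nu_q(f)=\min_{0\le i\le s}\{\nu(f_iq^i)\}$; it is a valuation when $q$ is a key polynomial for $\nu$. Let $\mathcal{K}_n=\{f\in\mathbb{K}[x]\mid\nu_Q(f)<\nu(f)\text{ for all }Q\in\Psi_n\}$. A limit key polynomial for $\Psi_n$ is a monic polynomial $Q_n\in\mathcal{K}_n$ of least degree among the polynomials in $\mathcal{K}_n$. $f\in\mathbb{K}[x]$ is $\mathfrak{v}$-stable, for $\mathfrak{v}=\{\nu_Q\}_{Q\in\Psi_n}$, if there is $\bar Q\in\Psi_n$ with $\nu_Q(f)=\nu_{\bar Q}(f)$ for every $Q\in\Psi_n$ with $\nu_{\bar Q}\le\nu_Q$; in that case $\mathfrak{v}(f)=\nu_{\bar Q}(f)$. *)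

theory Defs
  imports "HOL-Library.Extended" "HOL-Algebra.Algebraic_Closure_Type"
begin

text \<open>
  A totally ordered abelian group \<open>\<Gamma>\<close> is a type \<open>'g\<close> of class \<^class>\<open>linordered_ab_group_add\<close>;
  \<open>\<Gamma> \<union> {\<infinity>}\<close> is the part of \<open>'g extended\<close> that omits \<^const>\<open>Minf\<close>, which is only
  used as the value \<open>-\<infinity>\<close> of \<open>\<delta>\<close> at constants.
\<close>

definition valuation :: "('a::comm_ring_1 \<Rightarrow> 'g::linordered_ab_group_add extended) \<Rightarrow> bool" where
  "valuation \<nu> \<longleftrightarrow>
     (\<forall>a. \<nu> a \<noteq> Minf) \<and>
     (\<forall>a b. \<nu> (a * b) = \<nu> a + \<nu> b) \<and>
     (\<forall>a b. \<nu> (a + b) \<ge> min (\<nu> a) (\<nu> b)) \<and>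
     \<nu> 1 = 0 \<and> \<nu> 0 = Pinf"

text \<open>Natural multiples; in particular \<open>0 \<cdot> \<infinity> = 0\<close>.\<close>

definition nmult :: "nat \<Rightarrow> 'a::comm_monoid_add \<Rightarrow> 'a" where
  "nmult m a = (\<Sum>_<m. a)"

text \<open>
  The ordered set \<open>V\<close>: since \<open>\<nu>\<^sub>0\<close> lives on the field and the other elements live on the polynomial
  ring, the elements are tagged by \<^const>\<open>Inl\<close> and \<^const>\<open>Inr\<close> respectively.
\<close>

definition extends_base ::
  "('k::field \<Rightarrow> 'g::linordered_ab_group_add extended) \<Rightarrow> ('k poly \<Rightarrow> 'g extended) \<Rightarrow> bool" where
  "extends_base \<nu>0 \<nu> \<longleftrightarrow> (\<forall>a. \<nu> [:a:] = \<nu>0 a)"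

definition val_space ::
  "('k::field \<Rightarrow> 'g::linordered_ab_group_add extended) \<Rightarrow>
     (('k \<Rightarrow> 'g extended) + ('k poly \<Rightarrow> 'g extended)) set" where
  "val_space \<nu>0 = {Inl \<nu>0} \<union> Inr ` {\<nu>. valuation \<nu> \<and> extends_base \<nu>0 \<nu>}"

fun val_le ::
  "('k::field \<Rightarrow> 'g::linordered_ab_group_add extended) + ('k poly \<Rightarrow> 'g extended) \<Rightarrow>
   ('k \<Rightarrow> 'g extended) + ('k poly \<Rightarrow> 'g extended) \<Rightarrow> bool" where
  "val_le (Inl _) _ \<longleftrightarrow> True"
| "val_le (Inr \<nu>) (Inr \<mu>) \<longleftrightarrow> (\<forall>f. \<nu> f \<le> \<mu> f)"
| "val_le (Inr _) (Inl _) \<longleftrightarrow> False"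

definition extends_ac ::
  "('k::field poly \<Rightarrow> 'g::linordered_ab_group_add extended) \<Rightarrow>
     ('k alg_closure poly \<Rightarrow> 'g extended) \<Rightarrow> bool" where
  "extends_ac \<nu> \<nu>bar \<longleftrightarrow> (\<forall>f. \<nu>bar (map_poly to_ac f) = \<nu> f)"

text \<open>
  In the following definitions \<open>\<nu>bar\<close> is a valuation on polynomials over the algebraic closure
  that extends \<open>\<nu>\<close>.  The value of \<open>delta\<close> at the zero polynomial is irrelevant.
\<close>

definition delta ::
  "('k::field alg_closure poly \<Rightarrow> 'g::linordered_ab_group_add extended) \<Rightarrow> 'k poly \<Rightarrow> 'g extended"
where
  "delta \<nu>bar f =
     (if degree f > 0 then Max ((\<lambda>a. \<nu>bar [:-a, 1:]) ` {a. poly (map_poly to_ac f) a = 0})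
      else Minf)"

definition key_poly ::
  "('k::field alg_closure poly \<Rightarrow> 'g::linordered_ab_group_add extended) \<Rightarrow> 'k poly \<Rightarrow> bool" where
  "key_poly \<nu>bar Q \<longleftrightarrow>
     lead_coeff Q = 1 \<and>
     (\<forall>f. f \<noteq> 0 \<longrightarrow> delta \<nu>bar f \<ge> delta \<nu>bar Q \<longrightarrow> degree f \<ge> degree Q)"

definition key_polys ::
  "('k::field alg_closure poly \<Rightarrow> 'g::linordered_ab_group_add extended) \<Rightarrow> nat \<Rightarrow> 'k poly set" where
  "key_polys \<nu>bar n = {Q. key_poly \<nu>bar Q \<and> degree Q = n}"

text \<open>
  The \<open>q\<close>-expansion \<open>f = f\<^sub>0 + f\<^sub>1 q + \<dots> + f\<^sub>s q\<^sup>s\<close> is encoded by the polynomial \<open>P\<close> over \<open>K[x]\<close> with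
  coefficients \<open>f\<^sub>i\<close>: the defining identity reads \<^prop>\<open>poly P q = f\<close>, and \<open>s\<close> is \<^term>\<open>degree P\<close>.
\<close>

definition expansion :: "'k::field poly \<Rightarrow> 'k poly \<Rightarrow> 'k poly poly" where
  "expansion q f = (THE P. poly P q = f \<and> (\<forall>i. degree (coeff P i) < degree q))"

lemma expansion_ex1:
  fixes q f :: "'k::field poly"
  assumes q: "degree q > 0"
  shows "\<exists>!P. poly P q = f \<and> (\<forall>i. degree (coeff P i) < degree q)"
proof (rule ex_ex1I)
  show "\<exists>P. poly P q = f \<and> (\<forall>i. degree (coeff P i) < degree q)"
  proof (induction "degree f" arbitrary: f rule: less_induct)
    case less
    show ?case
    proof (cases "degree f < degree q")
      case True
      then show ?thesis
        using q by (intro exI[of _ "[:f:]"]) (auto simp: coeff_pCons split: nat.splits)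
    next
      case False
      then have "degree (f div q) < degree f"
        using q by (simp add: degree_div_less)
      then obtain P where P: "poly P q = f div q" "\<forall>i. degree (coeff P i) < degree q"
        using less by blast
      have "degree (f mod q) < degree q"
        using q degree_mod_less_degree
        by (metis degree_0 degree_mod_less' less_irrefl)
      then show ?thesis
        using P by (intro exI[of _ "pCons (f mod q) P"])
          (auto simp: coeff_pCons mult.commute split: nat.splits)
    qed
  qed
next
  have "P = R" if "poly P q = poly R q" "\<forall>i. degree (coeff P i) < degree q"
      "\<forall>i. degree (coeff R i) < degree q" for P R :: "'k poly poly"
    using that
  proof (induction P arbitrary: R)
    case 0
    have "R = 0" if "poly R q = 0" "\<forall>i. degree (coeff R i) < degree q" for R
      using that
    proof (induction R)
      case (pCons a R)
      have deg: "degree a < degree q"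
        using pCons.prems(2)[rule_format, of 0] by simp
      have eq: "a + q * poly R q = 0" using pCons.prems(1) by simp
      then have "(a + q * poly R q) mod q = 0" by simp
      then have "a = 0" using deg by (simp add: mod_poly_less)
      moreover have "poly R q = 0" using eq q \<open>a = 0\<close> by auto
      moreover have "\<forall>i. degree (coeff R i) < degree q"
        using pCons.prems(2) by (metis coeff_pCons_Suc)
      ultimately show ?case using pCons.IH by simp
    qed simp
    then show ?case using 0 by simp
  next
    case (pCons a P)
    obtain b S where R: "R = pCons b S" by (cases R)
    have deg: "degree a < degree q" "degree b < degree q"
      using pCons.prems(2)[rule_format, of 0] pCons.prems(3)[rule_format, of 0] R by simp_all
    have eq: "a + q * poly P q = b + q * poly S q" using pCons.prems(1) R by simp
    then have "(a + q * poly P q) mod q = (b + q * poly S q) mod q" by simp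
    then have "a = b" using deg by (simp add: mod_poly_less)
    moreover have "poly P q = poly S q" using eq q \<open>a = b\<close> by auto
    moreover have "\<forall>i. degree (coeff P i) < degree q" "\<forall>i. degree (coeff S i) < degree q"
      using pCons.prems(2,3) R by (metis coeff_pCons_Suc)+
    ultimately show ?case using pCons.IH R by simp
  qed
  then show "P = R"
    if "poly P q = f \<and> (\<forall>i. degree (coeff P i) < degree q)"
       "poly R q = f \<and> (\<forall>i. degree (coeff R i) < degree q)" for P R
    using that by metis
qed

definition trunc ::
  "('k::field poly \<Rightarrow> 'g::linordered_ab_group_add extended) \<Rightarrow> 'k poly \<Rightarrow> 'k poly \<Rightarrow> 'g extended"
where
  "trunc \<nu> q f =
     (let P = expansion q f in Min ((\<lambda>i. \<nu> (coeff P i * q ^ i)) ` {..degree P}))"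

definition trunc_family ::
  "('k::field poly \<Rightarrow> 'g::linordered_ab_group_add extended) \<Rightarrow> 'k poly set \<Rightarrow>
     (('k \<Rightarrow> 'g extended) + ('k poly \<Rightarrow> 'g extended)) set" where
  "trunc_family \<nu> \<Psi> = (\<lambda>Q. Inr (trunc \<nu> Q)) ` \<Psi>"

definition limit_set ::
  "('k::field poly \<Rightarrow> 'g::linordered_ab_group_add extended) \<Rightarrow> 'k poly set \<Rightarrow> 'k poly set" where
  "limit_set \<nu> \<Psi> = {f. \<forall>Q\<in>\<Psi>. trunc \<nu> Q f < \<nu> f}"

definition limit_key_poly ::
  "('k::field poly \<Rightarrow> 'g::linordered_ab_group_add extended) \<Rightarrow> 'k poly set \<Rightarrow> 'k poly \<Rightarrow> bool" where
  "limit_key_poly \<nu> \<Psi> Q \<longleftrightarrow>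
     lead_coeff Q = 1 \<and> Q \<in> limit_set \<nu> \<Psi> \<and> (\<forall>f\<in>limit_set \<nu> \<Psi>. degree Q \<le> degree f)"

definition stable_at ::
  "('k::field poly \<Rightarrow> 'g::linordered_ab_group_add extended) \<Rightarrow> 'k poly set \<Rightarrow> 'k poly \<Rightarrow>
     'k poly \<Rightarrow> bool" where
  "stable_at \<nu> \<Psi> f Qbar \<longleftrightarrow>
     Qbar \<in> \<Psi> \<and>
     (\<forall>Q\<in>\<Psi>. val_le (Inr (trunc \<nu> Qbar)) (Inr (trunc \<nu> Q)) \<longrightarrow> trunc \<nu> Q f = trunc \<nu> Qbar f)"

definition stable ::
  "('k::field poly \<Rightarrow> 'g::linordered_ab_group_add extended) \<Rightarrow> 'k poly set \<Rightarrow> 'k poly \<Rightarrow> bool" where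
  "stable \<nu> \<Psi> f \<longleftrightarrow> (\<exists>Qbar. stable_at \<nu> \<Psi> f Qbar)"

text \<open>The value \<open>v(f)\<close> of a stable \<open>f\<close>; it does not depend on \<open>Qbar\<close> when the family is totally ordered.\<close>

definition stable_value ::
  "('k::field poly \<Rightarrow> 'g::linordered_ab_group_add extended) \<Rightarrow> 'k poly set \<Rightarrow> 'k poly \<Rightarrow> 'g extended"
where
  "stable_value \<nu> \<Psi> f = (THE c. \<exists>Qbar. stable_at \<nu> \<Psi> f Qbar \<and> c = trunc \<nu> Qbar f)"

definition has_maximum :: "('a \<Rightarrow> 'a \<Rightarrow> bool) \<Rightarrow> 'a set \<Rightarrow> bool" where
  "has_maximum r S \<longleftrightarrow> (\<exists>m\<in>S. \<forall>x\<in>S. r x m)"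

end

theory Submission
  imports Defs
begin

text \<open>
  Everything rests on two facts about the truncations \<open>\<nu>\<^sub>Q\<close> at key polynomials \<open>Q\<close> of degree \<open>n\<close>.

  First, \<open>\<nu>\<^sub>Q\<close> is a valuation. If \<open>a\<close> is a root of \<open>Q\<close> for which \<open>x - a\<close> has the largest value, then
  every polynomial \<open>f\<close> of degree below \<open>n\<close> has the same value as the constant \<open>f(a)\<close>, because all
  its roots are further from \<open>x\<close> than \<open>a\<close>. As a product and its remainder modulo \<open>Q\<close> agree at \<open>a\<close>,
  they have the same value (\<open>key_poly_valuation_mod\<close>), and this is all that a truncation needs in order
  to be multiplicative (\<open>valuation_trunc\<close>).

  Second, the truncations are ordered like the values \<open>\<nu>(Q)\<close> (\<open>trunc_mono\<close>), and the value of \<open>f\<close>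
  grows strictly along the family until it reaches \<open>\<nu>(f)\<close>: if \<open>\<nu>(Q) < \<nu>(R)\<close> and
  \<open>\<nu>\<^sub>Q(f) = \<nu>\<^sub>R(f)\<close>, then this value is \<open>\<nu>(f)\<close> (\<open>trunc_eq_trunc_imp_eq\<close>).

  Since the values \<open>\<nu>(Q)\<close> have no maximum, neither has the family, and \<open>f\<close> is stable exactly when some
  \<open>\<nu>\<^sub>Q(f)\<close> equals \<open>\<nu>(f)\<close>, which is then its stable value. The polynomials that are not stable
  are therefore those from which a limit key polynomial is chosen with least degree. The coefficients
  of an expansion in the limit key polynomial have smaller degree, so their stable values are their
  values under \<open>\<nu>\<close>, and the formula for the truncation is its definition.
\<close>

section \<open>Addition with infinite values\<close>

text \<open>
  Adding a strict inequality to a weak one stays strict only while the smaller weak side is finite;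
  every strictness argument below has to rule out infinite values for this reason.
\<close>

lemma extended_add_le_less_mono:
  fixes a b c d :: "'g::linordered_ab_group_add extended"
  assumes "a \<le> b" "c < d" "a \<noteq> Pinf" "a \<noteq> Minf"
  shows "a + c < b + d"
  using assms by (cases a; cases b; cases c; cases d) (auto intro: add_le_less_mono)

lemma extended_add_less_le_mono:
  fixes a b c d :: "'g::linordered_ab_group_add extended"
  assumes "a < b" "c \<le> d" "c \<noteq> Pinf" "c \<noteq> Minf"
  shows "a + c < b + d"
  using extended_add_le_less_mono[OF assms(2,1,3,4)] by (simp add: add.commute)

lemma extended_add_Pinf:
  fixes a :: "'g::linordered_ab_group_add extended"
  shows "Pinf + a = Pinf" "a + Pinf = Pinf"
  by (cases a; simp)+

lemma extended_less_Pinf: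
  fixes a :: "'g::linordered_ab_group_add extended"
  shows "a < Pinf \<longleftrightarrow> a \<noteq> Pinf"
  by (cases a) auto

section \<open>Elementary properties of valuations\<close>

lemma valuationD:
  assumes "valuation \<nu>"
  shows "\<nu> a \<noteq> Minf" "\<nu> (a * b) = \<nu> a + \<nu> b" "min (\<nu> a) (\<nu> b) \<le> \<nu> (a + b)"
    "\<nu> 1 = 0" "\<nu> 0 = Pinf"
  using assms by (auto simp: valuation_def)

lemma nmult_0 [simp]: "nmult 0 a = 0"
  and nmult_Suc [simp]: "nmult (Suc m) a = nmult m a + a"
  by (simp_all add: nmult_def)

lemma nmult_mono:
  fixes a b :: "'g::linordered_ab_group_add extended"
  shows "a \<le> b \<Longrightarrow> nmult m a \<le> nmult m b"
  by (induction m) (auto intro: add_mono)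

lemma valuation_power: "valuation \<nu> \<Longrightarrow> \<nu> (q ^ m) = nmult m (\<nu> q)"
  by (induction m) (auto simp: valuationD add.commute)

lemma valuation_minus:
  fixes \<nu> :: "'a::comm_ring_1 \<Rightarrow> 'g::linordered_ab_group_add extended"
  assumes v: "valuation \<nu>"
  shows "\<nu> (- a) = \<nu> a"
proof -
  have "\<nu> (-1) + \<nu> (-1) = 0"
    using valuationD(2)[OF v, of "-1" "-1"] valuationD(4)[OF v] by simp
  then have "\<nu> (-1) = 0"
    by (cases "\<nu> (-1)") (auto simp: zero_extended_def)
  then show ?thesis
    using valuationD(2)[OF v, of "-1" a] by simp
qed

lemma valuation_diff_ge:
  assumes v: "valuation \<nu>"
  shows "min (\<nu> a) (\<nu> b) \<le> \<nu> (a - b)"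
  using valuationD(3)[OF v, of a "- b"] by (simp add: valuation_minus[OF v])

lemma valuation_add_ge:
  assumes "valuation \<nu>" "c \<le> \<nu> a" "c \<le> \<nu> b"
  shows "c \<le> \<nu> (a + b)"
  using valuationD(3)[OF assms(1), of a b] assms(2,3) by (meson min.bounded_iff order_trans)

lemma valuation_add_gt:
  assumes "valuation \<nu>" "c < \<nu> a" "c < \<nu> b"
  shows "c < \<nu> (a + b)"
  using valuationD(3)[OF assms(1), of a b] assms(2,3) by (meson min_less_iff_conj order_less_le_trans)

lemma valuation_diff_gt:
  assumes "valuation \<nu>" "c < \<nu> a" "c < \<nu> b"
  shows "c < \<nu> (a - b)"
  using valuation_add_gt[of \<nu> c a "- b"] assms by (simp add: valuation_minus)

lemma valuation_add_eq:
  assumes v: "valuation \<nu>" and less: "\<nu> a < \<nu> b"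
  shows "\<nu> (a + b) = \<nu> a"
proof (rule antisym)
  show "\<nu> a \<le> \<nu> (a + b)"
    using valuation_add_ge[OF v, of "\<nu> a" a b] less by simp
  show "\<nu> (a + b) \<le> \<nu> a"
    using valuation_diff_gt[OF v, of "\<nu> a" "a + b" b] less by (auto simp: not_le[symmetric])
qed

lemma valuation_sum_ge:
  assumes v: "valuation \<nu>" and "finite A" "\<And>x. x \<in> A \<Longrightarrow> c \<le> \<nu> (h x)"
  shows "c \<le> \<nu> (sum h A)"
  using assms(2,3) by (induction A) (auto simp: valuationD(5)[OF v] intro: valuation_add_ge[OF v])

lemma valuation_sum_gt:
  assumes v: "valuation \<nu>" and "finite A" "\<And>x. x \<in> A \<Longrightarrow> c < \<nu> (h x)" and "c \<noteq> Pinf"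
  shows "c < \<nu> (sum h A)"
  using assms(2,3)
  by (induction A)
    (auto simp: valuationD(5)[OF v] extended_less_Pinf assms(4) intro: valuation_add_gt[OF v])

section \<open>Expansions and truncations\<close>

lemma poly_expansion:
  fixes q f :: "'k::field poly"
  assumes "degree q > 0"
  shows "poly (expansion q f) q = f" "degree (coeff (expansion q f) i) < degree q"
  using theI'[OF expansion_ex1[OF assms, of f]] by (auto simp: expansion_def)

lemma expansion_eqI:
  fixes q f :: "'k::field poly"
  assumes "degree q > 0" "poly P q = f" "\<And>i. degree (coeff P i) < degree q"
  shows "expansion q f = P"
  unfolding expansion_def using assms by (intro the1_equality expansion_ex1) auto

text \<open>
  Coefficients beyond the degree of the expansion contribute the value \<open>\<infinity>\<close>, so the minimum may be
  taken over all indices, and expansions of different lengths can be compared termwise.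
\<close>

lemma le_trunc_iff:
  assumes v: "valuation \<nu>"
  shows "c \<le> trunc \<nu> q f \<longleftrightarrow> (\<forall>i. c \<le> \<nu> (coeff (expansion q f) i * q ^ i))"
proof -
  have "\<nu> (coeff (expansion q f) i * q ^ i) = Pinf" if "i > degree (expansion q f)" for i
    using that by (simp add: coeff_eq_0 valuationD(5)[OF v])
  then have "c \<le> \<nu> (coeff (expansion q f) i * q ^ i)" if "i > degree (expansion q f)" for i
    using that by simp
  then have "(\<forall>i. c \<le> \<nu> (coeff (expansion q f) i * q ^ i)) \<longleftrightarrow>
      (\<forall>i\<in>{..degree (expansion q f)}. c \<le> \<nu> (coeff (expansion q f) i * q ^ i))"
    by (meson atMost_iff not_le)
  then show ?thesis
    by (simp add: trunc_def Let_def)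
qed

lemma trunc_attained: "\<exists>i. trunc \<nu> q f = \<nu> (coeff (expansion q f) i * q ^ i)"
proof -
  have "trunc \<nu> q f \<in> (\<lambda>i. \<nu> (coeff (expansion q f) i * q ^ i)) ` {..degree (expansion q f)}"
    unfolding trunc_def Let_def by (rule Min_in) auto
  then show ?thesis by auto
qed

lemma trunc_of_small_degree:
  assumes "degree f < degree q"
  shows "trunc \<nu> q f = \<nu> f"
proof -
  have "expansion q f = [:f:]"
    using assms by (intro expansion_eqI) (auto simp: coeff_pCons split: nat.splits)
  then show ?thesis by (simp add: trunc_def)
qed

lemma trunc_linear:
  assumes "degree a < degree q"
  shows "trunc \<nu> q (a + q) = min (\<nu> a) (\<nu> q)"
proof -
  have "expansion q (a + q) = [:a, 1:]"
    using assms by (intro expansion_eqI) (auto simp: coeff_pCons split: nat.splits)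
  then show ?thesis by (simp add: trunc_def atMost_Suc min.commute)
qed

text \<open>
  This is the ultrametric inequality for \<open>\<mu>\<close> applied to the \<open>q\<close>-expansion. The case \<open>\<mu> = \<nu>\<close> bounds
  a truncation by \<open>\<nu>\<close>, and the case where \<open>\<mu>\<close> is another truncation of \<open>\<nu>\<close> compares the two.
\<close>

lemma trunc_le_valuation:
  assumes v: "valuation \<nu>" and m: "valuation \<mu>" and q: "degree q > 0"
    and small: "\<And>a. degree a < degree q \<Longrightarrow> \<nu> a \<le> \<mu> a" and "\<nu> q \<le> \<mu> q"
  shows "trunc \<nu> q f \<le> \<mu> f"
proof -
  let ?P = "expansion q f"
  have "trunc \<nu> q f \<le> \<mu> (\<Sum>i\<le>degree ?P. coeff ?P i * q ^ i)"
  proof (rule valuation_sum_ge[OF m])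
    fix i
    have "trunc \<nu> q f \<le> \<nu> (coeff ?P i * q ^ i)"
      using le_trunc_iff[OF v, of "trunc \<nu> q f" q f] by simp
    also have "\<dots> \<le> \<mu> (coeff ?P i * q ^ i)"
      using small[OF poly_expansion(2)[OF q]] assms(5)
      by (simp add: valuationD(2)[OF v] valuationD(2)[OF m] valuation_power[OF v]
          valuation_power[OF m] add_mono nmult_mono)
    finally show "trunc \<nu> q f \<le> \<mu> (coeff ?P i * q ^ i)" .
  qed simp
  then show ?thesis
    using poly_expansion(1)[OF q, of f] by (simp add: poly_altdef)
qed

lemma trunc_le:
  assumes "valuation \<nu>" "degree q > 0"
  shows "trunc \<nu> q f \<le> \<nu> f"
  by (rule trunc_le_valuation) (use assms in auto)

lemma trunc_add_ge:
  assumes v: "valuation \<nu>" and q: "degree q > 0"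
  shows "min (trunc \<nu> q f) (trunc \<nu> q g) \<le> trunc \<nu> q (f + g)"
proof -
  have "expansion q (f + g) = expansion q f + expansion q g"
    using q by (intro expansion_eqI) (auto simp: poly_expansion intro!: degree_add_less)
  moreover have "min (trunc \<nu> q f) (trunc \<nu> q g) \<le>
      \<nu> (coeff (expansion q f) i * q ^ i + coeff (expansion q g) i * q ^ i)" for i
    using le_trunc_iff[OF v, of "trunc \<nu> q f" q f] le_trunc_iff[OF v, of "trunc \<nu> q g" q g]
    by (intro valuation_add_ge[OF v]) (auto simp: min_le_iff_disj)
  ultimately show ?thesis
    by (simp add: le_trunc_iff[OF v] algebra_simps)
qed

section \<open>Products of expansions\<close>

lemma degree_mult_div_less:
  fixes a b q :: "'k::field poly"
  assumes "degree a < degree q" "degree b < degree q"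
  shows "degree (a * b div q) < degree q"
proof (cases "degree (a * b) < degree q")
  case True
  then show ?thesis using assms by (simp add: div_poly_less)
next
  case False
  have "q \<noteq> 0" using assms by auto
  then have "degree (a * b mod q) \<le> degree (a * b)"
    using False degree_mod_less[of q "a * b"] by auto
  then have le: "degree (q * (a * b div q)) \<le> degree (a * b)"
    unfolding minus_mod_eq_mult_div[symmetric] by (intro degree_diff_le) auto
  show ?thesis
  proof (cases "a * b div q = 0")
    case True
    then show ?thesis using assms by simp
  next
    case nz: False
    then show ?thesis
      using le degree_mult_le[of a b] assms \<open>q \<noteq> 0\<close> by (simp add: degree_mult_eq)
  qed
qed

lemma sum_div_poly:
  fixes h :: "'b \<Rightarrow> 'k::field poly"
  shows "sum h A div q = (\<Sum>x\<in>A. h x div q)"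
  by (induction A rule: infinite_finite_induct) (auto simp: poly_div_add_left)

lemma sum_mod_poly:
  fixes h :: "'b \<Rightarrow> 'k::field poly"
  shows "sum h A mod q = (\<Sum>x\<in>A. h x mod q)"
  by (induction A rule: infinite_finite_induct) (auto simp: poly_mod_add_left)

text \<open>
  Multiplying two expansions gives coefficients of degree below \<open>2 \<cdot> degree q\<close>, so a single division
  by \<open>q\<close>, carrying each quotient to the next coefficient, yields the expansion of the product.
\<close>

lemma coeff_expansion_mult:
  fixes q f g :: "'k::field poly"
  assumes q: "degree q > 0"
  defines "F \<equiv> coeff (expansion q f)" and "G \<equiv> coeff (expansion q g)"
  shows "coeff (expansion q (f * g)) k =
    (\<Sum>a\<le>k. F a * G (k - a) mod q) + (\<Sum>a<k. F a * G (k - Suc a) div q)"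
proof -
  define C where "C = expansion q f * expansion q g"
  define E where "E = map_poly (\<lambda>c. c mod q) C + pCons 0 (map_poly (\<lambda>c. c div q) C)"
  have coeff_C: "coeff C k = (\<Sum>a\<le>k. F a * G (k - a))" for k
    by (simp add: C_def F_def G_def coeff_mult)
  have "coeff E k = (\<Sum>a\<le>k. F a * G (k - a) mod q) + (\<Sum>a<k. F a * G (k - Suc a) div q)" for k
    by (cases k) (simp_all add: E_def coeff_map_poly coeff_C sum_div_poly sum_mod_poly
        lessThan_Suc_atMost del: sum.atMost_Suc)
  note coeff_E = this
  have "degree (F a * G b mod q) < degree q" for a b
    using q by (metis degree_0 degree_mod_less' less_irrefl)
  moreover have "degree (F a * G b div q) < degree q" for a b
    unfolding F_def G_def by (intro degree_mult_div_less poly_expansion q)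
  ultimately have "degree (coeff E k) < degree q" for k
    unfolding coeff_E using q by (intro degree_add_less degree_sum_less) auto
  moreover have "poly (map_poly (\<lambda>c. c mod q) D) q + q * poly (map_poly (\<lambda>c. c div q) D) q = poly D q"
    for D
  proof (induction D)
    case (pCons c D)
    have "poly (map_poly (\<lambda>c. c mod q) (pCons c D)) q + q * poly (map_poly (\<lambda>c. c div q) (pCons c D)) q
      = (c mod q + q * (c div q))
        + q * (poly (map_poly (\<lambda>c. c mod q) D) q + q * poly (map_poly (\<lambda>c. c div q) D) q)"
      by (simp add: map_poly_pCons algebra_simps)
    then show ?case using pCons.IH by simp
  qed simp
  then have "poly E q = f * g"
    using q by (simp add: E_def C_def poly_expansion)
  ultimately have "expansion q (f * g) = E"
    using q by (intro expansion_eqI) auto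
  then show ?thesis by (simp add: coeff_E)
qed

text \<open>
  A truncation is multiplicative as soon as reduction modulo \<open>q\<close> preserves the value of products
  of two polynomials of small degree. Then the quotient part of such a product has at least the
  value of the product, so reducing and carrying never lowers a value, which gives one inequality,
  and equality if one of the values is infinite. Otherwise take the first indices \<open>i\<close>, \<open>j\<close> at which the expansions of \<open>f\<close> and \<open>g\<close>
  attain their minima: in the coefficient of \<open>q ^ (i + j)\<close> every contribution other than that of
  \<open>i\<close> and \<open>j\<close> involves an earlier index, and so has a strictly larger value.
\<close>

lemma valuation_trunc:
  fixes \<nu> :: "'k::field poly \<Rightarrow> 'g::linordered_ab_group_add extended"
  assumes v: "valuation \<nu>" and q: "degree q > 0" and fin: "\<nu> q \<noteq> Pinf"
    and red: "\<And>a b. degree a < degree q \<Longrightarrow> degree b < degree q \<Longrightarrow> \<nu> (a * b mod q) = \<nu> (a * b)"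
  shows "valuation (trunc \<nu> q)"
proof -
  let ?c = "\<lambda>f. coeff (expansion q f)"
  let ?t = "\<lambda>f i. \<nu> (?c f i * q ^ i)"
  have le_t: "trunc \<nu> q f \<le> ?t f i" for f i
    using le_trunc_iff[OF v, of "trunc \<nu> q f" q f] by simp
  have split: "\<nu> (?c f a * ?c g b * q ^ (a + b)) = ?t f a + ?t g b" for f g a b
    by (simp add: valuationD(2)[OF v] power_add ac_simps)
  have mod_term: "\<nu> (?c f a * ?c g b mod q * q ^ (a + b)) = ?t f a + ?t g b" for f g a b
    using red[OF poly_expansion(2)[OF q] poly_expansion(2)[OF q], of f a g b] split[of f a g b]
    by (simp add: valuationD(2)[OF v])
  have div_term: "?t f a + ?t g b \<le> \<nu> (?c f a * ?c g b div q * q ^ k)"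
    if k: "k = Suc (a + b)" for f g a b k
  proof -
    have "(?c f a * ?c g b div q) * q ^ k
      = ?c f a * ?c g b * q ^ (a + b) - ?c f a * ?c g b mod q * q ^ (a + b)"
    proof -
      have "?c f a * ?c g b div q * q = ?c f a * ?c g b - ?c f a * ?c g b mod q"
        by (simp add: minus_mod_eq_div_mult)
      then have "?c f a * ?c g b div q * q * q ^ (a + b)
          = (?c f a * ?c g b - ?c f a * ?c g b mod q) * q ^ (a + b)"
        by (rule arg_cong)
      then show ?thesis by (simp only: k power_Suc left_diff_distrib mult.assoc)
    qed
    then show ?thesis
      using valuation_diff_ge[OF v, of "?c f a * ?c g b * q ^ (a + b)"
          "?c f a * ?c g b mod q * q ^ (a + b)"] split[of f a g b] mod_term[of f a g b]
      by simp
  qed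
  have coeff_fg: "?c (f * g) k * q ^ k =
      (\<Sum>a\<le>k. ?c f a * ?c g (k - a) mod q * q ^ k) + (\<Sum>a<k. ?c f a * ?c g (k - Suc a) div q * q ^ k)"
    for f g k
    by (simp add: coeff_expansion_mult[OF q] sum_distrib_right distrib_right)
  have ge: "trunc \<nu> q f + trunc \<nu> q g \<le> trunc \<nu> q (f * g)" for f g
    unfolding le_trunc_iff[OF v] coeff_fg
  proof (intro allI valuation_add_ge[OF v] valuation_sum_ge[OF v])
    fix k a
    show "trunc \<nu> q f + trunc \<nu> q g \<le> \<nu> (?c f a * ?c g (k - a) mod q * q ^ k)" if "a \<in> {..k}"
      using that mod_term[of f a g "k - a"] by (simp add: add_mono le_t)
    show "trunc \<nu> q f + trunc \<nu> q g \<le> \<nu> (?c f a * ?c g (k - Suc a) div q * q ^ k)" if "a \<in> {..<k}"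
      using that add_mono[OF le_t le_t] by (intro order_trans[OF _ div_term]) auto
  qed auto
  have not_Minf: "trunc \<nu> q f \<noteq> Minf" for f
    using trunc_attained[of \<nu> q f] valuationD(1)[OF v] by metis
  have mult: "trunc \<nu> q (f * g) = trunc \<nu> q f + trunc \<nu> q g" for f g
  proof (cases "trunc \<nu> q f = Pinf \<or> trunc \<nu> q g = Pinf")
    case True
    then have "trunc \<nu> q f + trunc \<nu> q g = Pinf"
      by (auto simp: extended_add_Pinf)
    then show ?thesis using ge[of f g] by simp
  next
    case False
    define c where "c = trunc \<nu> q f + trunc \<nu> q g"
    have c: "c \<noteq> Pinf"
      using False by (cases "trunc \<nu> q f"; cases "trunc \<nu> q g") (auto simp: c_def)
    define i where "i = (LEAST i. trunc \<nu> q f = ?t f i)"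
    define j where "j = (LEAST j. trunc \<nu> q g = ?t g j)"
    have i: "?t f i = trunc \<nu> q f"
      unfolding i_def using LeastI_ex[OF trunc_attained[of \<nu> q f]] by simp
    have j: "?t g j = trunc \<nu> q g"
      unfolding j_def using LeastI_ex[OF trunc_attained[of \<nu> q g]] by simp
    have before_i: "trunc \<nu> q f < ?t f a" if "a < i" for a
      using not_less_Least[OF that[unfolded i_def]] le_t[of f a] by simp
    have before_j: "trunc \<nu> q g < ?t g b" if "b < j" for b
      using not_less_Least[OF that[unfolded j_def]] le_t[of g b] by simp
    have strict: "c < ?t f a + ?t g b" if "a < i \<or> b < j" for a b
      using that unfolding c_def
    proof
      assume "a < i"
      then show "trunc \<nu> q f + trunc \<nu> q g < ?t f a + ?t g b"
        using False not_Minf by (intro extended_add_less_le_mono before_i le_t) auto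
    next
      assume "b < j"
      then show "trunc \<nu> q f + trunc \<nu> q g < ?t f a + ?t g b"
        using False not_Minf by (intro extended_add_le_less_mono before_j le_t) auto
    qed
    define k where "k = i + j"
    let ?main = "?c f i * ?c g j mod q * q ^ k"
    let ?mods = "\<Sum>a\<in>{..k} - {i}. ?c f a * ?c g (k - a) mod q * q ^ k"
    let ?divs = "\<Sum>a<k. ?c f a * ?c g (k - Suc a) div q * q ^ k"
    have main: "\<nu> ?main = c"
      by (simp add: k_def mod_term i j c_def)
    have "c < \<nu> ?mods"
    proof (rule valuation_sum_gt[OF v _ _ c])
      fix a assume a: "a \<in> {..k} - {i}"
      then have "a < i \<or> k - a < j" by (auto simp: k_def)
      from strict[OF this] show "c < \<nu> (?c f a * ?c g (k - a) mod q * q ^ k)"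
        using mod_term[of f a g "k - a"] a by simp
    qed simp
    moreover have "c < \<nu> ?divs"
    proof (rule valuation_sum_gt[OF v _ _ c])
      fix a assume a: "a \<in> {..<k}"
      then have "a < i \<or> k - Suc a < j" by (auto simp: k_def)
      from strict[OF this] show "c < \<nu> (?c f a * ?c g (k - Suc a) div q * q ^ k)"
        using div_term[of k a "k - Suc a" f g] a by simp
    qed simp
    ultimately have "\<nu> (?main + (?mods + ?divs)) = c"
      using valuation_add_eq[OF v, of ?main "?mods + ?divs"] valuation_add_gt[OF v] main by simp
    moreover have "?c (f * g) k * q ^ k = ?main + (?mods + ?divs)"
      unfolding coeff_fg by (subst sum.remove[of _ i]) (auto simp: k_def)
    ultimately have "trunc \<nu> q (f * g) \<le> c"
      using le_t[of "f * g" k] by simp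
    then show ?thesis using ge[of f g] by (simp add: c_def)
  qed
  have "trunc \<nu> q 0 = \<nu> 0" "trunc \<nu> q 1 = \<nu> 1"
    using q by (auto intro: trunc_of_small_degree)
  then show ?thesis
    unfolding valuation_def using mult not_Minf trunc_add_ge[OF v q] valuationD[OF v] by auto
qed

section \<open>Key polynomials\<close>

lemma map_poly_to_ac_add:
  "map_poly to_ac (f + g) = map_poly to_ac f + map_poly to_ac g"
  by (intro poly_eqI) (simp add: coeff_map_poly)

lemma map_poly_to_ac_mult:
  "map_poly to_ac (f * g) = map_poly to_ac f * map_poly to_ac g"
  by (intro poly_eqI) (simp add: coeff_map_poly coeff_mult to_ac_sum)

lemma degree_map_to_ac [simp]: "degree (map_poly to_ac f) = degree f"
  by (rule degree_map_poly) simp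

text \<open>
  If \<open>x - b\<close> has smaller value than \<open>x - a\<close>, then the constant \<open>a - b\<close> has the value of \<open>x - b\<close>.
  Over an algebraically closed field this passes from the linear factors to the whole polynomial.
\<close>

lemma valuation_eq_evaluation:
  fixes w :: "'c::alg_closed_field poly \<Rightarrow> 'g::linordered_ab_group_add extended"
  assumes w: "valuation w"
    and "\<And>b. poly p b = 0 \<Longrightarrow> w [:- b, 1:] < w [:- a, 1:]"
  shows "w p = w [:poly p a:]"
  using assms(2)
proof (induction "degree p" arbitrary: p rule: less_induct)
  case less
  show ?case
  proof (cases "degree p = 0")
    case True
    then obtain c where "p = [:c:]" by (auto elim: degree_eq_zeroE)
    then show ?thesis by simp
  next
    case False
    then obtain b where b: "poly p b = 0"
      using alg_closed_imp_poly_has_root by blast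
    then obtain r where r: "p = [:- b, 1:] * r"
      using poly_eq_0_iff_dvd by blast
    have "r \<noteq> 0" using False r by auto
    then have "degree p = Suc (degree r)"
      unfolding r by (subst degree_mult_eq) auto
    then have IH: "w r = w [:poly r a:]"
      using less.prems by (intro less.hyps) (auto simp: r)
    have "[:a - b:] = [:- b, 1:] + - [:- a, 1:]" by simp
    then have "w [:a - b:] = w [:- b, 1:]"
      using valuation_add_eq[OF w, of "[:- b, 1:]" "- [:- a, 1:]"] less.prems[OF b]
      by (simp only: valuation_minus[OF w])
    moreover have "[:poly p a:] = [:a - b:] * [:poly r a:]"
      by (simp add: r algebra_simps)
    ultimately show ?thesis
      using IH by (simp only: r valuationD(2)[OF w])
  qed
qed

text \<open>
  Let \<open>a\<close> be a root of \<open>Q\<close> realising \<open>\<delta>(Q)\<close>. A polynomial of degree below that of the key polynomial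
  \<open>Q\<close> has only roots \<open>b\<close> for which \<open>x - b\<close> has value below \<open>\<delta>(Q)\<close>, so its value can be read off at \<open>a\<close>,
  where a product and its remainder modulo \<open>Q\<close> agree.
\<close>

lemma key_poly_valuation_mod:
  fixes \<nu> :: "'k::field poly \<Rightarrow> 'g::linordered_ab_group_add extended"
  assumes w: "valuation \<nu>bar" and ext: "extends_ac \<nu> \<nu>bar"
    and key: "key_poly \<nu>bar Q" and Q: "degree Q > 0"
    and f: "degree f < degree Q" and g: "degree g < degree Q"
  shows "\<nu> (f * g mod Q) = \<nu> (f * g)"
proof -
  let ?m = "map_poly to_ac"
  let ?R = "\<lambda>f. (\<lambda>a. \<nu>bar [:- a, 1:]) ` {a. poly (?m f) a = 0}"
  have fin: "finite (?R f)" if "f \<noteq> 0" for f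
    using that by (intro finite_imageI poly_roots_finite) (simp add: map_poly_eq_0_iff)
  have "?R Q \<noteq> {}"
    using alg_closed_imp_poly_has_root[of "?m Q"] Q by auto
  then have "Max (?R Q) \<in> ?R Q"
    using Q by (intro Max_in fin) auto
  then obtain a where a: "poly (?m Q) a = 0" "delta \<nu>bar Q = \<nu>bar [:- a, 1:]"
    using Q by (auto simp: delta_def)
  have small: "\<nu> h = \<nu>bar [:poly (?m h) a:]" if h: "degree h < degree Q" for h
  proof (cases "h = 0")
    case True
    then show ?thesis using ext by (auto simp: extends_ac_def valuationD[OF w] dest: spec[of _ 0])
  next
    case False
    have less: "delta \<nu>bar h < delta \<nu>bar Q"
      using key h False unfolding key_poly_def by (meson not_le)
    have "\<nu>bar [:- b, 1:] < \<nu>bar [:- a, 1:]" if b: "poly (?m h) b = 0" for b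
    proof -
      have "degree h > 0"
      proof (rule ccontr)
        assume "\<not> degree h > 0"
        then obtain c where "h = [:c:]" by (auto elim: degree_eq_zeroE)
        then show False using b False by (auto simp: map_poly_pCons)
      qed
      then have "\<nu>bar [:- b, 1:] \<le> delta \<nu>bar h"
        using b fin[OF False] by (auto simp: delta_def)
      then show ?thesis using less a by simp
    qed
    then have "\<nu>bar (?m h) = \<nu>bar [:poly (?m h) a:]"
      by (intro valuation_eq_evaluation[OF w])
    then show ?thesis using ext by (simp add: extends_ac_def)
  qed
  have "\<nu> (f * g) = \<nu>bar (?m f * ?m g)"
    using ext by (simp add: extends_ac_def flip: map_poly_to_ac_mult)
  also have "\<dots> = \<nu> f + \<nu> g"
    using ext by (simp add: valuationD(2)[OF w] extends_ac_def)
  also have "\<dots> = \<nu>bar ([:poly (?m f) a:] * [:poly (?m g) a:])"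
    by (simp only: small[OF f] small[OF g] valuationD(2)[OF w])
  also have "[:poly (?m f) a:] * [:poly (?m g) a:] = [:poly (?m (f * g)) a:]"
    by (simp add: map_poly_to_ac_mult)
  also have "poly (?m (f * g)) a = poly (?m (f * g div Q * Q + f * g mod Q)) a"
    by simp
  also have "\<dots> = poly (?m (f * g mod Q)) a"
    unfolding map_poly_to_ac_add map_poly_to_ac_mult by (simp add: a)
  also have "\<nu>bar [:\<dots>:] = \<nu> (f * g mod Q)"
    using Q by (intro small[symmetric]) (metis degree_0 degree_mod_less' less_irrefl)
  finally show ?thesis ..
qed

section \<open>Comparing truncations at polynomials of the same degree\<close>

lemma degree_diff_monic_less:
  fixes Q R :: "'k::field poly"
  assumes "lead_coeff Q = 1" "lead_coeff R = 1" "degree Q = degree R" "degree R > 0"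
  shows "degree (Q - R) < degree R"
proof -
  have "coeff (Q - R) (degree R) = 0"
    using assms by (metis coeff_diff diff_self)
  then have "degree (Q - R) \<noteq> degree R"
    using assms(4) by (metis degree_0 leading_coeff_0_iff less_irrefl)
  moreover have "degree (Q - R) \<le> degree R"
    using assms(3) by (intro degree_diff_le) auto
  ultimately show ?thesis by simp
qed

lemma trunc_monic_same_degree:
  fixes Q R :: "'k::field poly"
  assumes "lead_coeff Q = 1" "lead_coeff R = 1" "degree Q = degree R" "degree R > 0"
  shows "trunc \<nu> R Q = min (\<nu> (Q - R)) (\<nu> R)"
  using trunc_linear[OF degree_diff_monic_less[OF assms], of \<nu>] by simp

text \<open>
  The difference of two monic polynomials of the same degree has smaller degree, where truncations
  agree with \<open>\<nu>\<close>; hence \<open>\<nu>\<^sub>R(Q)\<close> is at least \<open>\<nu>(Q)\<close> and the general comparison applies.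
\<close>

lemma trunc_mono:
  assumes v: "valuation \<nu>" and vR: "valuation (trunc \<nu> R)"
    and deg: "lead_coeff Q = 1" "lead_coeff R = 1" "degree Q = degree R" "degree R > 0"
    and le: "\<nu> Q \<le> \<nu> R"
  shows "trunc \<nu> Q f \<le> trunc \<nu> R f"
proof (rule trunc_le_valuation[OF v vR])
  have "\<nu> Q \<le> \<nu> (Q - R)"
    using valuation_diff_ge[OF v, of Q R] le by simp
  then show "\<nu> Q \<le> trunc \<nu> R Q"
    using le by (simp add: trunc_monic_same_degree[OF deg])
qed (use deg in \<open>auto simp: trunc_of_small_degree\<close>)

text \<open>
  Combined with \<open>\<nu>\<^sub>R(R) = \<nu>(R)\<close>, this shows that \<open>R\<close> itself separates \<open>\<nu>\<^sub>R\<close> from \<open>\<nu>\<^sub>Q\<close>.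
\<close>

lemma trunc_monic_of_less:
  assumes v: "valuation \<nu>"
    and deg: "lead_coeff Q = 1" "lead_coeff R = 1" "degree Q = degree R" "degree R > 0"
    and less: "\<nu> Q < \<nu> R"
  shows "trunc \<nu> Q R = \<nu> Q"
proof -
  have "\<nu> Q \<le> \<nu> (R - Q)"
    using valuation_diff_ge[OF v, of R Q] less by simp
  then show ?thesis
    using trunc_monic_same_degree[OF deg(2,1) deg(3)[symmetric], of \<nu>] deg(3,4)
    by (simp add: min_absorb2)
qed

text \<open>
  A value that does not grow from \<open>\<nu>\<^sub>Q\<close> to \<open>\<nu>\<^sub>R\<close> has already reached \<open>\<nu>\<close>. Write \<open>f = a + R h\<close> with
  \<open>a\<close> of small degree, on which \<open>\<nu>\<^sub>Q\<close>, \<open>\<nu>\<^sub>R\<close> and \<open>\<nu>\<close> agree. The value of \<open>R\<close> grows strictly, so if the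
  common value of \<open>f\<close> is finite then \<open>R h\<close> has larger value than \<open>f\<close> under \<open>\<nu>\<^sub>R\<close>, hence under \<open>\<nu>\<close>,
  and both values of \<open>f\<close> are that of \<open>a\<close>.
\<close>

lemma trunc_eq_trunc_imp_eq:
  assumes v: "valuation \<nu>" and vQ: "valuation (trunc \<nu> Q)" and vR: "valuation (trunc \<nu> R)"
    and deg: "lead_coeff Q = 1" "lead_coeff R = 1" "degree Q = degree R" "degree R > 0"
    and less: "\<nu> Q < \<nu> R" and eq: "trunc \<nu> Q f = trunc \<nu> R f"
  shows "trunc \<nu> R f = \<nu> f"
proof (cases "trunc \<nu> R f = Pinf")
  case True
  then show ?thesis using trunc_le[OF v deg(4), of f] by simp
next
  case False
  define c where "c = trunc \<nu> R f"
  obtain a P where P: "expansion R f = pCons a P" by (cases "expansion R f")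
  define h where "h = poly P R"
  have f: "f = a + R * h"
    using poly_expansion(1)[OF deg(4), of f] by (simp add: P h_def)
  have a_deg: "degree a < degree R"
    using poly_expansion(2)[OF deg(4), of f 0] by (simp add: P)
  then have a_vals: "trunc \<nu> Q a = \<nu> a" "trunc \<nu> R a = \<nu> a"
    using deg by (simp_all add: trunc_of_small_degree)
  have c_le: "c \<le> \<nu> a"
    using le_trunc_iff[OF v, of c R f, THEN iffD1, THEN spec[of _ 0]] by (simp add: c_def P)
  have "trunc \<nu> R R = \<nu> R"
    using trunc_linear[of 0 R \<nu>] deg by (simp add: valuationD(5)[OF v])
  then have R: "trunc \<nu> Q R < trunc \<nu> R R"
    using trunc_monic_of_less[OF v deg less] less by simp
  have h: "trunc \<nu> Q h \<le> trunc \<nu> R h"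
    using less by (intro trunc_mono[OF v vR deg]) simp
  have "c \<le> trunc \<nu> Q (R * h)"
    using valuation_diff_ge[OF vQ, of f a] c_le eq a_vals by (simp add: f c_def min_def split: if_splits)
  also have "\<dots> = trunc \<nu> Q R + trunc \<nu> Q h"
    by (rule valuationD(2)[OF vQ])
  finally have c_le_Rh: "c \<le> trunc \<nu> Q R + trunc \<nu> Q h" .
  have Rh: "c < trunc \<nu> R (R * h)"
  proof (cases "trunc \<nu> Q h = Pinf")
    case True
    then have "trunc \<nu> R (R * h) = Pinf"
      using h by (simp add: valuationD(2)[OF vR] extended_add_Pinf)
    then show ?thesis using False by (simp add: c_def extended_less_Pinf)
  next
    case False
    then have "trunc \<nu> Q R + trunc \<nu> Q h < trunc \<nu> R R + trunc \<nu> R h"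
      using R h valuationD(1)[OF vQ] by (intro extended_add_less_le_mono) auto
    then show ?thesis using c_le_Rh by (simp add: valuationD(2)[OF vR])
  qed
  have "\<not> c < \<nu> a"
  proof
    assume "c < \<nu> a"
    then have "c < trunc \<nu> R f"
      unfolding f using Rh a_vals by (intro valuation_add_gt[OF vR]) auto
    then show False by (simp add: c_def)
  qed
  then have "\<nu> a = c" using c_le by simp
  moreover have "c < \<nu> (R * h)"
    using Rh trunc_le[OF v deg(4), of "R * h"] by simp
  ultimately have "\<nu> f = c"
    unfolding f using valuation_add_eq[OF v, of a "R * h"] by simp
  then show ?thesis by (simp add: c_def)
qed

section \<open>Stable values\<close>

text \<open>
  Of two truncations at which \<open>f\<close> is stable one lies above the other, so they give \<open>f\<close> the same value.
\<close>

lemma stable_value_eq: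
  assumes total: "\<And>Q R. Q \<in> \<Psi> \<Longrightarrow> R \<in> \<Psi> \<Longrightarrow>
      val_le (Inr (trunc \<nu> Q)) (Inr (trunc \<nu> R)) \<or> val_le (Inr (trunc \<nu> R)) (Inr (trunc \<nu> Q))"
    and Q: "stable_at \<nu> \<Psi> f Q"
  shows "stable_value \<nu> \<Psi> f = trunc \<nu> Q f"
  unfolding stable_value_def
proof (rule the_equality)
  show "c = trunc \<nu> Q f" if "\<exists>R. stable_at \<nu> \<Psi> f R \<and> c = trunc \<nu> R f" for c
    using that Q total unfolding stable_at_def by metis
qed (use Q in blast)

text \<open>
  All truncations are bounded by \<open>\<nu>\<close>, so a truncation that reaches \<open>\<nu>(f)\<close> leaves no room to grow.
\<close>

lemma stable_at_of_trunc_eq: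
  assumes "valuation \<nu>" "\<And>R. R \<in> \<Psi> \<Longrightarrow> degree R > 0" "Q \<in> \<Psi>" "trunc \<nu> Q f = \<nu> f"
  shows "stable_at \<nu> \<Psi> f Q"
  unfolding stable_at_def
proof (intro conjI ballI impI antisym)
  fix R assume R: "R \<in> \<Psi>" "val_le (Inr (trunc \<nu> Q)) (Inr (trunc \<nu> R))"
  show "trunc \<nu> R f \<le> trunc \<nu> Q f"
    using trunc_le[OF assms(1) assms(2)[OF R(1)], of f] assms(4) by simp
  show "trunc \<nu> Q f \<le> trunc \<nu> R f"
    using R(2) by simp
qed (fact assms(3))

theorem corollary5p5:
  fixes \<nu>0 :: "'k::field \<Rightarrow> 'g::linordered_ab_group_add extended"
    and \<nu> :: "'k poly \<Rightarrow> 'g extended"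
    and \<nu>bar :: "'k alg_closure poly \<Rightarrow> 'g extended"
    and n :: nat
    and \<Psi> :: "'k poly set"
    and Qn :: "'k poly"
    and \<gamma> :: "'g extended"
  assumes divisible: "\<And>(g::'g) m. m > 0 \<Longrightarrow> \<exists>h. nmult m h = g"
    and base: "valuation \<nu>0" "\<And>a. \<nu>0 a = Pinf \<Longrightarrow> a = 0"
    and \<nu>: "Inr \<nu> \<in> val_space \<nu>0"
    and \<nu>bar: "valuation \<nu>bar" "extends_ac \<nu> \<nu>bar"
    and \<Psi>: "\<Psi> = key_polys \<nu>bar n"
    and nonempty: "\<Psi> \<noteq> {}"
    and no_max: "\<not> has_maximum (\<le>) (\<nu> ` \<Psi>)"
    and Qn: "limit_key_poly \<nu> \<Psi> Qn"
    and \<gamma>: "\<gamma> = \<nu> Qn"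
  shows "(trunc_family \<nu> \<Psi> \<subseteq> val_space \<nu>0 \<and>
          (\<forall>\<mu>\<in>trunc_family \<nu> \<Psi>. \<forall>\<mu>'\<in>trunc_family \<nu> \<Psi>. val_le \<mu> \<mu>' \<or> val_le \<mu>' \<mu>) \<and>
          \<not> has_maximum val_le (trunc_family \<nu> \<Psi>)) \<and>
         (\<not> stable \<nu> \<Psi> Qn \<and> (\<forall>f. \<not> stable \<nu> \<Psi> f \<longrightarrow> degree Qn \<le> degree f)) \<and>
         (\<forall>f. trunc \<nu> Qn f =
           Min ((\<lambda>j. stable_value \<nu> \<Psi> (coeff (expansion Qn f) j) + nmult j \<gamma>) `
                {..degree (expansion Qn f)}))"
proof -
  have v: "valuation \<nu>" and ext: "\<nu> [:a:] = \<nu>0 a" for a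
    using \<nu> by (auto simp: val_space_def extends_base_def)
  have key: "key_poly \<nu>bar Q" and monic: "lead_coeff Q = 1" and degn: "degree Q = n"
    if "Q \<in> \<Psi>" for Q
    using that by (auto simp: \<Psi> key_polys_def key_poly_def)
  have above: "\<exists>R\<in>\<Psi>. \<nu> Q < \<nu> R" if "Q \<in> \<Psi>" for Q
    using no_max that by (auto simp: has_maximum_def not_le)
  have fin: "\<nu> Q \<noteq> Pinf" if "Q \<in> \<Psi>" for Q
    using above[OF that] by auto
  have n: "n > 0"
  proof (rule ccontr)
    \<comment> \<open>The only monic polynomial of degree 0 is 1, whose value would then be the maximum.\<close>
    assume "\<not> n > 0"
    then have one: "Q = 1" if "Q \<in> \<Psi>" for Q
      using monic[OF that] degn[OF that] by (auto elim!: degree_eq_zeroE simp: one_pCons)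
    obtain Q R where "Q \<in> \<Psi>" "R \<in> \<Psi>" "\<nu> Q < \<nu> R"
      using nonempty above by blast
    then show False using one[of Q] one[of R] by simp
  qed
  have deg: "degree Q > 0" if "Q \<in> \<Psi>" for Q
    using n degn[OF that] by simp
  have vQ: "valuation (trunc \<nu> Q)" if "Q \<in> \<Psi>" for Q
    using key_poly_valuation_mod[OF \<nu>bar key[OF that] deg[OF that]]
    by (intro valuation_trunc v deg fin that)
  have mono: "trunc \<nu> Q f \<le> trunc \<nu> R f" if "Q \<in> \<Psi>" "R \<in> \<Psi>" "\<nu> Q \<le> \<nu> R" for Q R f
    using that by (intro trunc_mono v vQ monic deg) (auto simp: degn)
  have total: "val_le (Inr (trunc \<nu> Q)) (Inr (trunc \<nu> R)) \<or>
      val_le (Inr (trunc \<nu> R)) (Inr (trunc \<nu> Q))" if "Q \<in> \<Psi>" "R \<in> \<Psi>" for Q R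
    using mono[of Q R] mono[of R Q] that linear[of "\<nu> Q" "\<nu> R"] by auto

  have family: "trunc_family \<nu> \<Psi> \<subseteq> val_space \<nu>0"
    using vQ deg by (auto simp: trunc_family_def val_space_def extends_base_def ext trunc_of_small_degree)
  have no_max_family: "\<not> has_maximum val_le (trunc_family \<nu> \<Psi>)"
  proof
    assume "has_maximum val_le (trunc_family \<nu> \<Psi>)"
    then obtain Q where Q: "Q \<in> \<Psi>" "\<And>R f. R \<in> \<Psi> \<Longrightarrow> trunc \<nu> R f \<le> trunc \<nu> Q f"
      by (auto simp: has_maximum_def trunc_family_def)
    obtain R where R: "R \<in> \<Psi>" "\<nu> Q < \<nu> R" using above[OF Q(1)] by blast
    have "trunc \<nu> Q R = \<nu> Q"
      using Q(1) R by (intro trunc_monic_of_less v monic deg) (auto simp: degn)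
    moreover have "trunc \<nu> R R = \<nu> R"
      using trunc_linear[of 0 R \<nu>] deg[OF R(1)] by (simp add: valuationD(5)[OF v])
    ultimately show False using Q(2)[OF R(1), of R] R(2) by simp
  qed

  have Qn_not_stable: "\<not> stable \<nu> \<Psi> Qn"
  proof
    assume "stable \<nu> \<Psi> Qn"
    then obtain Q where Q: "stable_at \<nu> \<Psi> Qn Q" by (auto simp: stable_def)
    then have Q\<Psi>: "Q \<in> \<Psi>" unfolding stable_at_def by blast
    then obtain R where R: "R \<in> \<Psi>" "\<nu> Q < \<nu> R" using above by blast
    have "val_le (Inr (trunc \<nu> Q)) (Inr (trunc \<nu> R))"
      using mono[OF Q\<Psi> R(1)] R(2) by simp
    then have "trunc \<nu> R Qn = trunc \<nu> Q Qn"
      using Q R(1) unfolding stable_at_def by blast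
    then have "trunc \<nu> R Qn = \<nu> Qn"
      using Q\<Psi> R by (intro trunc_eq_trunc_imp_eq[of \<nu> Q R] v vQ monic deg) (simp_all add: degn)
    then show False using Qn R(1) by (auto simp: limit_key_poly_def limit_set_def)
  qed

  have reached: "\<exists>Q\<in>\<Psi>. stable_at \<nu> \<Psi> f Q \<and> trunc \<nu> Q f = \<nu> f" if "degree f < degree Qn" for f
  proof -
    have "f \<notin> limit_set \<nu> \<Psi>"
      using Qn that by (auto simp: limit_key_poly_def not_le[symmetric])
    then obtain Q where Q: "Q \<in> \<Psi>" "\<not> trunc \<nu> Q f < \<nu> f" by (auto simp: limit_set_def)
    then have "trunc \<nu> Q f = \<nu> f" using trunc_le[OF v deg[OF Q(1)], of f] by simp
    then show ?thesis using stable_at_of_trunc_eq[OF v deg] Q(1) by blast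
  qed

  have Qn_deg: "degree Qn > 0"
  proof (rule ccontr)
    assume "\<not> degree Qn > 0"
    moreover obtain Q where "Q \<in> \<Psi>" using nonempty by blast
    ultimately have "trunc \<nu> Q Qn = \<nu> Qn" using deg by (simp add: trunc_of_small_degree)
    then show False using Qn \<open>Q \<in> \<Psi>\<close> by (auto simp: limit_key_poly_def limit_set_def)
  qed
  have "stable_value \<nu> \<Psi> (coeff (expansion Qn f) j) = \<nu> (coeff (expansion Qn f) j)" for f j
    using reached[OF poly_expansion(2)[OF Qn_deg]] stable_value_eq[OF total] by metis
  then have "\<forall>f. trunc \<nu> Qn f =
      Min ((\<lambda>j. stable_value \<nu> \<Psi> (coeff (expansion Qn f) j) + nmult j \<gamma>) `
        {..degree (expansion Qn f)})"
    by (simp add: trunc_def Let_def \<gamma> valuationD(2)[OF v] valuation_power[OF v])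
  moreover have "\<forall>f. \<not> stable \<nu> \<Psi> f \<longrightarrow> degree Qn \<le> degree f"
    using reached by (meson not_le stable_def)
  ultimately show ?thesis
    using family no_max_family Qn_not_stable total by (auto simp: trunc_family_def)
qed

end
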